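(* There is no universal coalition path; that is, there is no positive integer $k$ such that every one of the $18$ graphs $K_1$, $K_2$, $\overline{K_2}$, $K_1\cup K_2$, $P_3$, $K_3$, $K_{1,3}$, $2K_2$, $P_4$, $C_4$, $F_1$, $K_4-e$, $P_2\cup P_3$, $F_2$, $B_1$, $P_5$, $S(1,2)$, $S(2,2)$ is isomorphic to $\mathrm{CG}(P_k,\Psi)$ for some coalition partition $\Psi$ of the path $P_k$.
   Context: For a graph $G$ with vertex set $V$, a set $S\subseteq V$ is a dominating set if every vertex of $V\setminus S$ is adjacent to a vertex of $S$. Two disjoint sets $V_1,V_2\subseteq V$ form a coalition in $G$ if neither is a dominating set of $G$ but $V_1\cup V_2$ is. A coalition partition of $G$ is a partition $\Psi=\{V_1,\ldots,V_k\}$ of $V$ such that every $V_i\in\Psi$ is either a dominating set of $G$ with $|V_i|=1$, or is not a dominating set and forms a coalition with some $V_j\in\Psi$. Given a coalition partition $\Psi$ of $G$, the coalition graph $\mathrm{CG}(G,\Psi)$ has vertex set $\Psi$, two members adjacent iff they form a coalition in $G$. $P_k$ is the path on $k$ vertices. Graphs: $F_1$ is a triangle with one pendant edge; $F_2$ is a $4$-cycle with one pendant edge; $B_1$ (the bull) is a triangle with pendant edges at two distinct vertices; $S(r,s)$ is the double star, a tree with exactly two adjacent non-leaf vertices having $r$ and $s$ leaf neighbors; $K_4-e$ is $K_4$ minus an edge; $2K_2$ is two disjoint edges; $\overline{K_2}$ is two isolated vertices; $\cup$ denotes disjoint union. *)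

theory Defs
  imports "Graph_Theory.Graph_Theory" "HOL-Library.Disjoint_Sets"
begin

text \<open>
  Finite simple graphs are the digraphs satisfying \<^locale>\<open>pair_graph\<close>: each edge is represented
  by its two opposite arcs.
\<close>

definition ugraph :: "'a set \<Rightarrow> ('a \<times> 'a) set \<Rightarrow> 'a pair_pre_digraph" where
  "ugraph V E = \<lparr>pverts = V, parcs = E \<union> E\<inverse>\<rparr>"

lemma pair_graph_ugraph:
  assumes "finite V" "E \<subseteq> V \<times> V" "irrefl E"
  shows "pair_graph (ugraph V E)"
proof -
  have "finite E" using assms by (meson finite_SigmaI finite_subset)
  with assms show ?thesis
    by unfold_locales
      (auto simp: ugraph_def irrefl_def symmetric_def intro!: symI)
qed


section \<open>Coalitions\<close>

definition dominating_set :: "'a pair_pre_digraph \<Rightarrow> 'a set \<Rightarrow> bool" where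
  "dominating_set G S \<longleftrightarrow>
     S \<subseteq> pverts G \<and> (\<forall>v \<in> pverts G - S. \<exists>u \<in> S. (v, u) \<in> parcs G)"

definition coalition :: "'a pair_pre_digraph \<Rightarrow> 'a set \<Rightarrow> 'a set \<Rightarrow> bool" where
  "coalition G A B \<longleftrightarrow>
     A \<subseteq> pverts G \<and> B \<subseteq> pverts G \<and> A \<inter> B = {} \<and>
     \<not> dominating_set G A \<and> \<not> dominating_set G B \<and> dominating_set G (A \<union> B)"

text \<open>
  Parts of a partition are nonempty, so disjointness of the two sets in a coalition already forces
  \<open>A \<noteq> B\<close> below.
\<close>

definition coalition_partition :: "'a pair_pre_digraph \<Rightarrow> 'a set set \<Rightarrow> bool" where
  "coalition_partition G \<Psi> \<longleftrightarrow>
     partition_on (pverts G) \<Psi> \<and>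
     (\<forall>A \<in> \<Psi>. (dominating_set G A \<and> card A = 1) \<or>
              (\<not> dominating_set G A \<and> (\<exists>B \<in> \<Psi>. coalition G A B)))"

definition coalition_graph :: "'a pair_pre_digraph \<Rightarrow> 'a set set \<Rightarrow> 'a set pair_pre_digraph" where
  "coalition_graph G \<Psi> =
     \<lparr>pverts = \<Psi>, parcs = {(A, B). A \<in> \<Psi> \<and> B \<in> \<Psi> \<and> coalition G A B}\<rparr>"

lemma pair_graph_coalition_graph:
  assumes "finite (pverts G)" "coalition_partition G \<Psi>"
  shows "pair_graph (coalition_graph G \<Psi>)"
proof -
  have p: "partition_on (pverts G) \<Psi>"
    using assms(2) by (simp add: coalition_partition_def)
  then have fin: "finite \<Psi>"
    using assms(1) finite_elements by blast
  have "finite {(A, B). A \<in> \<Psi> \<and> B \<in> \<Psi> \<and> coalition G A B}"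
    by (rule finite_subset[of _ "\<Psi> \<times> \<Psi>"]) (use fin in auto)
  moreover have "{} \<notin> \<Psi>"
    using p by (simp add: partition_on_def)
  ultimately show ?thesis
    using fin
    by unfold_locales
      (auto simp: coalition_graph_def symmetric_def coalition_def Un_commute Int_commute
        intro!: symI)
qed


section \<open>Concrete graphs\<close>

definition path_graph :: "nat \<Rightarrow> nat pair_pre_digraph" where
  "path_graph n = ugraph {..<n} {(i, Suc i) | i. Suc i < n}"

text \<open>The cycle is meant for \<open>n \<ge> 3\<close>.\<close>

definition cycle_graph :: "nat \<Rightarrow> nat pair_pre_digraph" where
  "cycle_graph n = ugraph {..<n} {(i, Suc i mod n) | i. i < n}"

definition edgeless_graph :: "nat \<Rightarrow> nat pair_pre_digraph" where
  "edgeless_graph n = ugraph {..<n} {}"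

definition complete_graph :: "nat \<Rightarrow> nat pair_pre_digraph" where
  "complete_graph n = ugraph {..<n} {(i, j). i < j \<and> j < n}"

definition complete_bipartite_graph :: "nat \<Rightarrow> nat \<Rightarrow> nat pair_pre_digraph" where
  "complete_bipartite_graph m n = ugraph {..<m + n} ({..<m} \<times> {m..<m + n})"

text \<open>The centres are \<open>0\<close> (with \<open>r\<close> leaves) and \<open>1\<close> (with \<open>s\<close> leaves).\<close>

definition double_star :: "nat \<Rightarrow> nat \<Rightarrow> nat pair_pre_digraph" where
  "double_star r s =
     ugraph {..<r + s + 2} ({(0, 1)} \<union> {0} \<times> {2..<r + 2} \<union> {1} \<times> {r + 2..<r + s + 2})"

text \<open>Vertices of \<open>G\<close> become even and vertices of \<open>H\<close> odd numbers.\<close>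

definition disjoint_union ::
    "nat pair_pre_digraph \<Rightarrow> nat pair_pre_digraph \<Rightarrow> nat pair_pre_digraph" where
  "disjoint_union G H =
     \<lparr>pverts = (\<lambda>v. 2 * v) ` pverts G \<union> (\<lambda>v. 2 * v + 1) ` pverts H,
      parcs = (\<lambda>(u, v). (2 * u, 2 * v)) ` parcs G \<union> (\<lambda>(u, v). (2 * u + 1, 2 * v + 1)) ` parcs H\<rparr>"

definition K4_minus_edge :: "nat pair_pre_digraph" where
  "K4_minus_edge =
     \<lparr>pverts = pverts (complete_graph 4), parcs = parcs (complete_graph 4) - {(0, 1), (1, 0)}\<rparr>"

definition F1_graph :: "nat pair_pre_digraph" where
  "F1_graph = ugraph {..<4} {(0, 1), (1, 2), (2, 0), (0, 3)}"

definition F2_graph :: "nat pair_pre_digraph" where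
  "F2_graph = ugraph {..<5} {(0, 1), (1, 2), (2, 3), (3, 0), (0, 4)}"

definition bull_graph :: "nat pair_pre_digraph" where
  "bull_graph = ugraph {..<5} {(0, 1), (1, 2), (2, 0), (0, 3), (1, 4)}"

lemma pair_graph_path_graph: "pair_graph (path_graph n)"
  unfolding path_graph_def by (rule pair_graph_ugraph) (auto simp: irrefl_def)

lemma complete_digraph_complete_graph: "complete_digraph n (with_proj (complete_graph n))"
proof -
  interpret pair_graph "complete_graph n"
    unfolding complete_graph_def by (rule pair_graph_ugraph) (auto simp: irrefl_def)
  have "graph (with_proj (complete_graph n))" by unfold_locales
  then show ?thesis
    by (auto simp: complete_digraph_def complete_graph_def ugraph_def)
qed

end

theory Submission
  imports Defs
begin

text \<open>
  The graphs \<open>K\<^sub>1\<close> and \<open>K\<^sub>2\<close> already exclude each other. A part that is the whole vertex set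
  dominates, so it must be a singleton; hence \<open>K\<^sub>1\<close> is a coalition graph of \<open>P\<^sub>k\<close> for \<open>k = 1\<close>
  only. But a partition of one vertex does not have two parts.
\<close>

text \<open>The only isomorphism invariant the argument uses: the vertex map of an isomorphism is
  injective, and its image is the other vertex set.\<close>

lemma card_pverts_digraph_iso:
  assumes "digraph_iso (with_proj G) (with_proj H)"
  shows "card (pverts G) = card (pverts H)"
proof -
  obtain h where h: "pre_digraph.digraph_isomorphism (with_proj G) h"
    "with_proj H = app_iso h (with_proj G)"
    using assms by (auto simp: digraph_iso_def)
  have "inj_on (iso_verts h) (pverts G)"
    using h(1) by (simp add: pre_digraph.digraph_isomorphism_def)
  moreover have "pverts H = iso_verts h ` pverts G"
    using arg_cong[OF h(2), of verts] by (simp add: app_iso_def)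
  ultimately show ?thesis
    by (simp add: card_image)
qed

lemma coalition_partition_one_part:
  assumes "coalition_partition G \<Psi>" "card \<Psi> = 1"
  shows "card (pverts G) = 1"
proof -
  obtain A where \<Psi>: "\<Psi> = {A}"
    using assms(2) by (rule card_1_singletonE)
  then have "partition_on (pverts G) {A}"
    using assms(1) by (simp add: coalition_partition_def)
  then have A: "A = pverts G" "A \<noteq> {}"
    by (auto simp: partition_on_def)
  \<comment> \<open>Coalition partners are disjoint, so the nonempty \<open>A\<close> is not its own
    partner. There is no other part, which leaves only the singleton alternative of the
    definition.\<close>
  have "\<not> coalition G A A"
    using A by (auto simp: coalition_def)
  then show ?thesis
    using assms(1) A \<Psi> by (auto simp: coalition_partition_def)
qed

text \<open>Parts are nonempty and disjoint, so their sizes, each at least 1, add up to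
  \<open>card A\<close>.\<close>

lemma card_partition_le:
  assumes "partition_on A P" "finite A"
  shows "card P \<le> card A"
proof -
  have fin: "finite P"
    using assms finite_elements by blast
  have "card P = (\<Sum>p\<in>P. 1)" by simp
  also have "\<dots> \<le> (\<Sum>p\<in>P. card p)"
  proof (rule sum_mono)
    fix p assume "p \<in> P"
    then have "p \<noteq> {}" "finite p"
      using assms by (auto simp: partition_on_def intro: finite_subset)
    then show "1 \<le> card p"
      by (simp add: Suc_leI card_gt_0_iff)
  qed
  also have "\<dots> = card (\<Union>P)"
    using assms
    by (intro card_Union_disjoint[symmetric])
      (auto simp: partition_on_def disjoint_def pairwise_def disjnt_def intro: finite_subset)
  finally show ?thesis
    using assms(1) by (simp add: partition_on_def)
qed

theorem theorem11:
  shows "\<not> (\<exists>k::nat. k > 0 \<and>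
    (\<forall>H \<in> {complete_graph 1, complete_graph 2, edgeless_graph 2,
            disjoint_union (complete_graph 1) (complete_graph 2),
            path_graph 3, complete_graph 3, complete_bipartite_graph 1 3,
            disjoint_union (complete_graph 2) (complete_graph 2),
            path_graph 4, cycle_graph 4, F1_graph, K4_minus_edge,
            disjoint_union (path_graph 2) (path_graph 3),
            F2_graph, bull_graph, path_graph 5, double_star 1 2, double_star 2 2}.
       \<exists>\<Psi>. coalition_partition (path_graph k) \<Psi> \<and>
           digraph_iso (with_proj H) (with_proj (coalition_graph (path_graph k) \<Psi>))))"
    (is "\<not> (\<exists>k. k > 0 \<and> (\<forall>H \<in> ?\<H>. ?realized k H))")
proof
  assume "\<exists>k. k > 0 \<and> (\<forall>H \<in> ?\<H>. ?realized k H)"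
  then obtain k where k: "\<forall>H \<in> ?\<H>. ?realized k H"
    by blast
  have verts: "pverts (path_graph k) = {..<k}" "pverts (complete_graph n) = {..<n}" for n
    by (simp_all add: path_graph_def complete_graph_def ugraph_def)
  \<comment> \<open>The vertices of a coalition graph are the parts of \<open>\<Psi>\<close>, so
    comparing vertex counts is enough and the arcs are forgotten.\<close>
  have parts: "\<exists>\<Psi>. coalition_partition (path_graph k) \<Psi> \<and> card \<Psi> = n"
    if "?realized k (complete_graph n)" for n
    using that card_pverts_digraph_iso by (fastforce simp: coalition_graph_def verts)
  have "?realized k (complete_graph 1)"
    by (rule bspec[OF k]) simp
  then have "k = 1"
    using parts coalition_partition_one_part verts(1) by fastforce
  have "?realized k (complete_graph 2)"
    by (rule bspec[OF k]) simp
  then obtain \<Psi> where "partition_on {..<k} \<Psi>" "card \<Psi> = 2"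
    using parts unfolding coalition_partition_def verts(1) by blast
  \<comment> \<open>With \<open>k = 1\<close>, the bound on the number of parts would give 2 \<le>
    1.\<close>
  then show False
    using card_partition_le \<open>k = 1\<close> by fastforce
qed

end
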